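(* Let $A_1=(x_1,y_1)$, $A_2=(x_2,y_2)$, $B_1=(u_1,v_1)$, $B_2=(u_2,v_2)$ be points in $\mathbb Z^2$ with $A_1\prec A_2$ and $B_1\prec B_2$. Then, for all $m\ge0$, $$\left|\mathcal P^{\ge 2m+1}_{A_1\to B_2,A_2\to B_1}\right|=\left|\mathcal P^{\ge 2m}_{A_1\to B_2,A_2\to B_1}\right|=\binom{u_2-x_1+v_2-y_1}{u_2-x_1+2m}\binom{u_1-x_2+v_1-y_2}{u_1-x_2-2m},$$ and for all $m\ge1$, $$\left|\mathcal P^{\ge 2m}_{A_1\to B_1,A_2\to B_2}\right|=\left|\mathcal P^{\ge 2m-1}_{A_1\to B_1,A_2\to B_2}\right|=\binom{u_2-x_1+v_2-y_1}{u_2-x_1+2m-1}\binom{u_1-x_2+v_1-y_2}{u_1-x_2-2m+1}.$$ Let now $A=(x,y)$ and $B=(u,v)$ be points in $\mathbb Z^2$. Then, for all $r\ge0$, $$\left|\mathcal P^{\ge r}_{A\to B_1,A\to B_2}\right|=\binom{u_2-x+v_2-y}{u_2-x+r}\binom{u_1-x+v_1-y}{u_1-x-r},$$ $$\left|\mathcal P^{\ge r}_{A_1\to B,A_2\to B}\right|=\binom{u-x_1+v-y_1}{u-x_1+r}\binom{u-x_2+v-y_2}{u-x_2-r},$$ $$\left|\mathcal P^{\ge r}_{A\to B,A\to B}\right|=\begin{cases}\displaystyle\binom{u-x+v-y}{u-x}^2 & \text{if } r=0,\\[3mm] \displaystyle 2\sum_{j\ge1}(-1)^{j-1}\binom{u-x+v-y}{u-x+r+j}\binom{u-x+v-y}{u-x-r-j}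 & \text{if } r\ge1.\end{cases}$$
   Context: Paths are lattice paths in $\mathbb Z^2$ with steps $N=(0,1)$ and $E=(1,0)$; $\mathcal P_{A\to B}$ is the set of such paths from $A$ to $B$. For points $A_1=(x_1,y_1)$, $A_2=(x_2,y_2)$, write $A_1\prec A_2$ if $x_1<x_2$ and $y_1>y_2$. A crossing of two paths $P$ and $Q$ is a common vertex $C$ such that: (i) $P$ and $Q$ disagree in the step arriving at $C$ (one arrives with an $N$, the other with an $E$), and they disagree again in some step after $C$ (comparing, for each $i\ge1$, the $i$th step of $P$ after $C$ with the $i$th step of $Q$ after $C$); (ii) at the first step after $C$ where $P$ and $Q$ disagree again, each path has the same type of step ($N$ or $E$) as it had when arriving at $C$. Let $\chi(P,Q)$ be the number of crossings of $P$ and $Q$. For points $A,A',B,B'\in\mathbb Z^2$ and $r\ge0$, $$\mathcal P^{\ge r}_{A\to B,A'\to B'}=\{(P,Q):P\in\mathcal P_{A\to B},\ Q\in\mathcal P_{A'\to B'},\ \chi(P,Q)\ge r\}.$$ For integers $n,k$, the binomial coefficient $\binom{n}{k}$ has its usual value if $0\le k\le n$ and is $0$ otherwise. *)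

theory Defs
  imports "HOL-Analysis.Infinite_Sum"
begin

datatype step = N | E

type_synonym point = "int \<times> int"

(* A path is its starting point together with its list of steps. *)
type_synonym path = "point \<times> step list"

fun move :: "point \<Rightarrow> step \<Rightarrow> point" where
  "move (x, y) N = (x, y + 1)"
| "move (x, y) E = (x + 1, y)"

(* The vertex reached after i steps; only meaningful for i \<le> length (snd P). *)
definition vertex :: "path \<Rightarrow> nat \<Rightarrow> point" where
  "vertex P i = foldl move (fst P) (take i (snd P))"

definition paths :: "point \<Rightarrow> point \<Rightarrow> path set" where
  "paths A B = {P. fst P = A \<and> vertex P (length (snd P)) = B}"

definition prec :: "point \<Rightarrow> point \<Rightarrow> bool" (infix "\<prec>" 50) where
  "A1 \<prec> A2 \<longleftrightarrow> fst A1 < fst A2 \<and> snd A1 > snd A2"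

(* A lattice path visits each vertex at most once, so a crossing is determined by its point C.
   C is the i-th vertex of P and the j-th vertex of Q, where i, j \<ge> 1 because both paths
   have to arrive at C by a step: s ! (i - 1) is the step arriving at C, and s ! (i + k) is
   the (k+1)-st step after C. The index k is that of the first disagreement after C, and
   comparisons only involve steps present in both paths. *)
definition is_crossing :: "path \<Rightarrow> path \<Rightarrow> point \<Rightarrow> bool" where
  "is_crossing P Q C \<longleftrightarrow>
    (\<exists>i j. 1 \<le> i \<and> i \<le> length (snd P) \<and> 1 \<le> j \<and> j \<le> length (snd Q) \<and>
       vertex P i = C \<and> vertex Q j = C \<and>
       snd P ! (i - 1) \<noteq> snd Q ! (j - 1) \<and>
       (\<exists>k. i + k < length (snd P) \<and> j + k < length (snd Q) \<and>
          (\<forall>l<k. snd P ! (i + l) = snd Q ! (j + l)) \<and>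
          snd P ! (i + k) \<noteq> snd Q ! (j + k) \<and>
          snd P ! (i + k) = snd P ! (i - 1) \<and>
          snd Q ! (j + k) = snd Q ! (j - 1)))"

definition crossings :: "path \<Rightarrow> path \<Rightarrow> nat" ("\<chi>") where
  "\<chi> P Q = card {C. is_crossing P Q C}"

definition path_pairs :: "nat \<Rightarrow> point \<Rightarrow> point \<Rightarrow> point \<Rightarrow> point \<Rightarrow> (path \<times> path) set" where
  "path_pairs r A B A' B' = {(P, Q). P \<in> paths A B \<and> Q \<in> paths A' B' \<and> \<chi> P Q \<ge> r}"

(* Zero outside 0 \<le> k \<le> n, unlike gchoose for negative n. *)
definition binom :: "int \<Rightarrow> int \<Rightarrow> nat" where
  "binom n k = (if 0 \<le> k \<and> k \<le> n then nat n choose nat k else 0)"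

end

theory Submission
  imports Defs
begin

text \<open>
  On each antidiagonal that both paths visit, one path lies north-west of the other or they share a
  vertex; a crossing is a change of sides, placed at the vertex where the paths meet.
  All the counts follow from one recurrence, obtained by deleting first steps: the step of the path
  that starts on the lower antidiagonal, or both steps if the starting points are level.
  Levelling the starting points in this way keeps the order \<open>\<prec>\<close>.

  Whether a meeting point is a crossing is only decided when the paths separate again.  So when the
  deletion reaches a common vertex, one has to remember that the first path arrived from the
  north-west.  The statistic \<open>crossings_nw\<close> does this: it adds the crossing at the common starting
  point that such an arrival would produce.  Only one case of the recurrence then changes
  anything: a first path that leaves a common vertex \<open>A\<close> with \<open>E\<close>, while the second leaves with
  \<open>N\<close>, uses up one crossing and is now south-east.  Exchanging the two paths restores the
  orientation and exchanges their end points.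

  The claimed products are the numbers \<open>shifted_pairs k\<close> of pairs of walks from \<open>A1\<close> to \<open>B2\<close>
  displaced by \<open>(k, -k)\<close>, and from \<open>A2\<close> to \<open>B1\<close> displaced by \<open>(-k, k)\<close>.  By Pascal's rule they
  satisfy the recurrence for starting points in general position.  At a common vertex they also
  do, because exchanging the starting points \<open>A + E\<close> and \<open>A + N\<close> has the same effect as lowering
  \<open>k\<close> by one, just as the number of required crossings goes down by one.  The relation between
  \<open>k\<close> and the required number \<open>r\<close> of crossings is \<open>k = r\<close>, except that for distinct end points the
  parity of the number of crossings is forced; then \<open>k\<close> is the even number in \<open>{r - 1, r}\<close> if the
  paths have to change sides, and the odd number in \<open>{r - 1, r}\<close> otherwise.  The result is
  \<open>card_pairs_nw\<close>, which covers all starting points \<open>A1 \<prec> A2\<close>.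

  For a common start \<open>A\<close> without any arrival, let \<open>f r\<close> be the number of pairs with at least \<open>r\<close>
  crossings.  Counting with the first or the second path as the one arriving from the north-west,
  every pair with at least \<open>r + 1\<close> crossings is counted twice, and every pair with exactly \<open>r\<close> is
  counted once, since exactly one of the two arrivals adds a crossing.  Hence \<open>f (r + 1) + f r\<close> is known.
  With distinct end points this gives \<open>f\<close> by induction from \<open>f 0\<close>; with equal end points the
  relation only holds for \<open>r > 0\<close>, since a pair of equal paths never separates, and solving it
  downwards from large \<open>r\<close> yields the alternating sum.
\<close>

section \<open>Points, walks and binomial coefficients\<close>

text \<open>
The height numbers the antidiagonals.  Every step raises it by one, so it measures the progress of a path
and allows steps of different paths to be compared.
\<close>

definition height :: "point \<Rightarrow> int" where
  "height A = fst A + snd A"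

definition weak_prec :: "point \<Rightarrow> point \<Rightarrow> bool" (infix "\<preceq>" 50) where
  "A \<preceq> B \<longleftrightarrow> A = B \<or> A \<prec> B"

definition walks :: "point \<Rightarrow> point \<Rightarrow> step list set" where
  "walks A B = {s. foldl move A s = B}"

lemma move_simps: "move A N = (fst A, snd A + 1)" "move A E = (fst A + 1, snd A)"
  by (cases A; simp)+

lemma fst_snd_move [simp]:
  "fst (move A N) = fst A" "snd (move A N) = snd A + 1"
  "fst (move A E) = fst A + 1" "snd (move A E) = snd A"
  by (simp_all add: move_simps)

text \<open>
Two paths with \<open>A1 \<prec> A2\<close> can only meet by a simultaneous step, and then the north-western one
steps \<open>E\<close> and the other one \<open>N\<close>.
\<close>

lemma move_neq_prec: "A1 \<prec> A2 \<Longrightarrow> move A1 a \<noteq> A2" "A1 \<prec> A2 \<Longrightarrow> move A2 a \<noteq> A1"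
  by (cases a; auto simp: prec_def move_simps prod_eq_iff)+

lemma move_eq_move_prec: "A1 \<prec> A2 \<Longrightarrow> move A1 a = move A2 b \<Longrightarrow> a = E \<and> b = N"
  by (cases a; cases b; auto simp: prec_def move_simps)

lemma height_move [simp]: "height (move A a) = height A + 1"
  by (cases a) (simp_all add: move_simps height_def)

lemma height_foldl_move: "height (foldl move A s) = height A + int (length s)"
  by (induction s arbitrary: A) auto

lemma length_walk: "s \<in> walks A B \<Longrightarrow> int (length s) = height B - height A"
  unfolding walks_def using height_foldl_move[of A s] by auto

lemma Cons_in_walks [simp]: "a # s \<in> walks A B \<longleftrightarrow> s \<in> walks (move A a) B"
  by (simp add: walks_def)

lemma finite_walks: "finite (walks A B)"
proof -
  have "(UNIV :: step set) = {N, E}"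
    using step.exhaust by auto
  then have "finite (UNIV :: step set)"
    by (metis finite.emptyI finite_insert)
  then have "finite {s :: step list. set s \<subseteq> UNIV \<and> length s = nat (height B - height A)}"
    by (rule finite_lists_length_eq)
  moreover have "walks A B \<subseteq> {s. set s \<subseteq> UNIV \<and> length s = nat (height B - height A)}"
    using length_walk by fastforce
  ultimately show ?thesis
    by (rule rev_finite_subset)
qed

lemma binom_pascal:
  assumes "1 \<le> n"
  shows "binom n k = binom (n - 1) k + binom (n - 1) (k - 1)"
proof -
  consider "k < 0" | "k = 0" | "1 \<le> k" "k < n" | "k = n" | "k > n"
    by linarith
  then show ?thesis
  proof cases
    case 3
    define k' n' where "k' = nat (k - 1)" and "n' = nat (n - 1)"
    have k': "k = int (Suc k')" and n': "n = int (Suc n')"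
      using 3 assms by (auto simp: k'_def n'_def)
    show ?thesis
      using 3 unfolding k' n' by (simp add: binom_def nat_add_distrib)
  qed (use assms in \<open>auto simp: binom_def\<close>)
qed

text \<open>
Used with the two maps that prepend \<open>N\<close> or \<open>E\<close> to a walk; the preimage then consists of the
possible continuations.
\<close>

lemma card_vimage_split:
  assumes "finite S" "inj f" "inj g" "range f \<inter> range g = {}" "S \<subseteq> range f \<union> range g"
  shows "card S = card (f -` S) + card (g -` S)"
proof -
  have S: "S = f ` (f -` S) \<union> g ` (g -` S)"
    using assms(5) by auto
  have "card S = card (f ` (f -` S)) + card (g ` (g -` S))"
    by (subst S, rule card_Un_disjoint) (use assms in \<open>auto intro: finite_subset[of _ S]\<close>)
  also have "\<dots> = card (f -` S) + card (g -` S)"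
    using assms(2,3) by (metis card_image inj_on_subset subset_UNIV)
  finally show ?thesis .
qed

lemma range_Cons_steps: "s \<noteq> [] \<Longrightarrow> s \<in> range ((#) N) \<union> range ((#) E)"
proof (cases s)
  case (Cons a t)
  then show ?thesis
    by (cases a) auto
qed simp

lemma card_walks_Cons:
  assumes "height A < height B"
  shows "card (walks A B) = card (walks (move A N) B) + card (walks (move A E) B)"
proof -
  have "s \<noteq> []" if "s \<in> walks A B" for s
    using length_walk[OF that] assms by auto
  then have "walks A B \<subseteq> range ((#) N) \<union> range ((#) E)"
    using range_Cons_steps by blast
  from card_vimage_split[OF finite_walks _ _ _ this] show ?thesis
    by (auto simp: vimage_def inj_def)
qed

lemma card_walks: "card (walks A B) = binom (height B - height A) (fst B - fst A)"
proof (induction "nat (height B - height A)" arbitrary: A)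
  case 0
  consider "A = B" | "A \<noteq> B" "height A = height B" | "height A > height B"
    using 0 by force
  then show ?case
  proof cases
    case 1
    have "walks B B = {[]}"
      using length_walk[of _ B B] by (auto simp: walks_def)
    with 1 show ?thesis
      by (simp add: binom_def)
  next
    case 2
    then have "s = []" if "s \<in> walks A B" for s
      using length_walk[OF that] by simp
    with 2 have "walks A B = {}"
      by (force simp: walks_def)
    moreover have "fst A \<noteq> fst B"
      using 2 by (auto simp: height_def prod_eq_iff)
    ultimately show ?thesis
      using 2 by (simp add: binom_def)
  next
    case 3
    then have "walks A B = {}"
      using length_walk[of _ A B] by fastforce
    with 3 show ?thesis
      by (simp add: binom_def)
  qed
next
  case (Suc n)
  then have lt: "height A < height B"
    by linarith
  have IH: "card (walks (move A a) B) = binom (height B - height A - 1) (fst B - fst (move A a))" for a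
    using Suc.hyps(1)[of "move A a"] Suc.hyps(2) by (simp add: algebra_simps)
  show ?case
    using lt unfolding card_walks_Cons[OF lt] IH
    by (simp add: binom_pascal[of "height B - height A"] move_simps algebra_simps)
qed

section \<open>Crossings under removal of first steps\<close>

lemma vertex_0 [simp]: "vertex (A, s) 0 = A"
  by (simp add: vertex_def)

lemma vertex_Cons_Suc [simp]: "vertex (A, a # s) (Suc i) = vertex (move A a, s) i"
  by (simp add: vertex_def)

lemma height_vertex: "i \<le> length s \<Longrightarrow> height (vertex (A, s) i) = height A + int i"
  by (simp add: vertex_def height_foldl_move)

lemma is_crossing_commute: "is_crossing P Q C \<longleftrightarrow> is_crossing Q P C"
proof -
  have "is_crossing Q P C" if "is_crossing P Q C" for P Q
  proof -
    from that obtain i j k where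
      "1 \<le> i" "i \<le> length (snd P)" "1 \<le> j" "j \<le> length (snd Q)" "vertex P i = C" "vertex Q j = C"
      "snd P ! (i - 1) \<noteq> snd Q ! (j - 1)" "i + k < length (snd P)" "j + k < length (snd Q)"
      "\<forall>l<k. snd P ! (i + l) = snd Q ! (j + l)" "snd P ! (i + k) \<noteq> snd Q ! (j + k)"
      "snd P ! (i + k) = snd P ! (i - 1)" "snd Q ! (j + k) = snd Q ! (j - 1)"
      unfolding is_crossing_def by blast
    then show ?thesis
      unfolding is_crossing_def
      by (intro exI[of _ j] exI[of _ i] conjI exI[of _ k]) auto
  qed
  then show ?thesis
    by blast
qed

lemma crossings_commute: "\<chi> P Q = \<chi> Q P"
  by (simp add: crossings_def is_crossing_commute)

lemma finite_crossings: "finite {C. is_crossing P Q C}"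
proof (rule finite_subset)
  show "{C. is_crossing P Q C} \<subseteq> vertex P ` {..length (snd P)}"
    unfolding is_crossing_def by blast
qed simp

text \<open>
The step \<open>c\<close> is the one that the first walk takes at the first disagreement.  As there are only two
steps, it determines the step of the second walk.
\<close>

fun diverge :: "step \<Rightarrow> step list \<Rightarrow> step list \<Rightarrow> bool" where
  "diverge c (a # s) (b # t) = (if a = b then diverge c s t else a = c)"
| "diverge c _ _ = False"

lemma ex_nat_split: "(\<exists>k. P k) \<longleftrightarrow> P 0 \<or> (\<exists>k. P (Suc k))"
  by (metis not0_implies_Suc)

lemma diverge_iff:
  "diverge c s t \<longleftrightarrow> (\<exists>k. k < length s \<and> k < length t \<and>
     (\<forall>l<k. s ! l = t ! l) \<and> s ! k \<noteq> t ! k \<and> s ! k = c)"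
proof (induction c s t rule: diverge.induct)
  case (1 c a s b t)
  then show ?case
    by (subst ex_nat_split) (auto simp: All_less_Suc2)
qed auto

text \<open>
The index \<open>i\<close> of the arriving step replaces the index \<open>i + 1\<close> of the vertex reached.  In this form
every ingredient has a simplification rule for \<open>Cons\<close>.
\<close>

lemma is_crossing_iff:
  "is_crossing (A1, s) (A2, t) C \<longleftrightarrow> (\<exists>i j. i < length s \<and> j < length t \<and>
     vertex (A1, s) (Suc i) = C \<and> vertex (A2, t) (Suc j) = C \<and>
     s ! i \<noteq> t ! j \<and> diverge (s ! i) (drop (Suc i) s) (drop (Suc j) t))"
proof -
  have two: "v = y" if "x \<noteq> y" "u \<noteq> v" "u = x" for x y u v :: step
    using that by (metis step.exhaust)
  show ?thesis
  proof
    assume "is_crossing (A1, s) (A2, t) C"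
    then obtain i j k where *:
      "1 \<le> i" "i \<le> length s" "1 \<le> j" "j \<le> length t" "vertex (A1, s) i = C" "vertex (A2, t) j = C"
      "s ! (i - 1) \<noteq> t ! (j - 1)" "i + k < length s" "j + k < length t"
      "\<forall>l<k. s ! (i + l) = t ! (j + l)" "s ! (i + k) \<noteq> t ! (j + k)"
      "s ! (i + k) = s ! (i - 1)"
      unfolding is_crossing_def snd_conv by blast
    have "diverge (s ! (i - 1)) (drop i s) (drop j t)"
      unfolding diverge_iff using * by (intro exI[of _ k]) auto
    with * show "\<exists>i j. i < length s \<and> j < length t \<and>
       vertex (A1, s) (Suc i) = C \<and> vertex (A2, t) (Suc j) = C \<and>
       s ! i \<noteq> t ! j \<and> diverge (s ! i) (drop (Suc i) s) (drop (Suc j) t)"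
      by (intro exI[of _ "i - 1"] exI[of _ "j - 1"]) auto
  next
    assume "\<exists>i j. i < length s \<and> j < length t \<and>
       vertex (A1, s) (Suc i) = C \<and> vertex (A2, t) (Suc j) = C \<and>
       s ! i \<noteq> t ! j \<and> diverge (s ! i) (drop (Suc i) s) (drop (Suc j) t)"
    then obtain i j where *: "i < length s" "j < length t"
       "vertex (A1, s) (Suc i) = C" "vertex (A2, t) (Suc j) = C"
       "s ! i \<noteq> t ! j" "diverge (s ! i) (drop (Suc i) s) (drop (Suc j) t)"
      by blast
    then obtain k where k: "Suc i + k < length s" "Suc j + k < length t"
      "\<forall>l<k. s ! (Suc i + l) = t ! (Suc j + l)" "s ! (Suc i + k) \<noteq> t ! (Suc j + k)"
      "s ! (Suc i + k) = s ! i"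
      unfolding diverge_iff by (auto simp: less_diff_conv add.commute)
    from two[OF *(5) k(4,5)] show "is_crossing (A1, s) (A2, t) C"
      unfolding is_crossing_def snd_conv using * k
      by (intro exI[of _ "Suc i"] exI[of _ "Suc j"] conjI exI[of _ k]) auto
  qed
qed

lemma is_crossing_higher:
  assumes "is_crossing (A1, s) (A2, t) C"
  shows "height A1 < height C"
proof -
  obtain i j where "i < length s" "j < length t"
    "vertex (A1, s) (Suc i) = C" "vertex (A2, t) (Suc j) = C"
    using assms unfolding is_crossing_iff by blast
  then show ?thesis
    using height_vertex[of "Suc i" s A1] by auto
qed

lemma crossings_Nil [simp]: "\<chi> (A1, []) (A2, t) = 0" "\<chi> (A1, s) (A2, []) = 0"
  by (simp_all add: crossings_def is_crossing_iff)

text \<open>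
The vertex after the first step is no higher than \<open>A2\<close>, whereas the second path has to make a
step before it arrives at a crossing.
\<close>

lemma is_crossing_Cons_left:
  assumes "height A1 < height A2"
  shows "is_crossing (A1, a # s) (A2, t) C \<longleftrightarrow> is_crossing (move A1 a, s) (A2, t) C"
proof -
  have "vertex (A2, t) (Suc j) \<noteq> move A1 a" if "j < length t" for j
    using assms that height_vertex[of "Suc j" t A2] by (auto dest: arg_cong[of _ _ height])
  then show ?thesis
    unfolding is_crossing_iff by (subst ex_nat_split) auto
qed

lemma crossings_Cons_left:
  "height A1 < height A2 \<Longrightarrow> \<chi> (A1, a # s) (A2, t) = \<chi> (move A1 a, s) (A2, t)"
  by (simp add: crossings_def is_crossing_Cons_left)

lemma crossings_Cons_right:
  "height A2 < height A1 \<Longrightarrow> \<chi> (A1, s) (A2, b # t) = \<chi> (A1, s) (move A2 b, t)"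
  by (metis crossings_Cons_left crossings_commute)

text \<open>
Vertices of equal height have equal indices on both paths, so the only crossing that can disappear
with the first steps is the one at which both of them end.
\<close>

lemma is_crossing_Cons_Cons:
  assumes "height A1 = height A2"
  shows "is_crossing (A1, a # s) (A2, b # t) C \<longleftrightarrow>
    is_crossing (move A1 a, s) (move A2 b, t) C \<or>
    move A1 a = C \<and> move A2 b = C \<and> a \<noteq> b \<and> diverge a s t"
proof -
  have 1: "vertex (move A2 b, t) (Suc j) \<noteq> move A1 a" if "j < length t" for j
    using assms that height_vertex[of "Suc j" t "move A2 b"] by (auto dest: arg_cong[of _ _ height])
  have 2: "vertex (move A1 a, s) (Suc i) \<noteq> move A2 b" if "i < length s" for i
    using assms that height_vertex[of "Suc i" s "move A1 a"] by (auto dest: arg_cong[of _ _ height])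
  define P where "P i j \<longleftrightarrow> i < length (a # s) \<and> j < length (b # t) \<and>
      vertex (A1, a # s) (Suc i) = C \<and> vertex (A2, b # t) (Suc j) = C \<and> (a # s) ! i \<noteq> (b # t) ! j \<and>
      diverge ((a # s) ! i) (drop (Suc i) (a # s)) (drop (Suc j) (b # t))" for i j
  have "P 0 0 \<longleftrightarrow> move A1 a = C \<and> move A2 b = C \<and> a \<noteq> b \<and> diverge a s t"
    by (auto simp: P_def)
  moreover have "\<not> P 0 (Suc j)" "\<not> P (Suc i) 0" for i j
    using 1[of j] 2[of i] by (auto simp: P_def)
  moreover have "(\<exists>i j. P (Suc i) (Suc j)) \<longleftrightarrow> is_crossing (move A1 a, s) (move A2 b, t) C"
    unfolding is_crossing_iff P_def by simp
  moreover have "is_crossing (A1, a # s) (A2, b # t) C \<longleftrightarrow> (\<exists>i j. P i j)"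
    unfolding is_crossing_iff P_def ..
  moreover have "(\<exists>i j. P i j) \<longleftrightarrow> P 0 0 \<or> (\<exists>j. P 0 (Suc j)) \<or> (\<exists>i. P (Suc i) 0) \<or> (\<exists>i j. P (Suc i) (Suc j))"
    by (metis not0_implies_Suc)
  ultimately show ?thesis
    by blast
qed

lemma crossings_Cons_Cons:
  assumes "height A1 = height A2"
  shows "\<chi> (A1, a # s) (A2, b # t) = \<chi> (move A1 a, s) (move A2 b, t) +
    (if move A1 a = move A2 b \<and> a \<noteq> b \<and> diverge a s t then 1 else 0)"
proof (cases "move A1 a = move A2 b \<and> a \<noteq> b \<and> diverge a s t")
  case True
  then have "{C. is_crossing (A1, a # s) (A2, b # t) C} =
      insert (move A1 a) {C. is_crossing (move A1 a, s) (move A2 b, t) C}"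
    using is_crossing_Cons_Cons[OF assms] by auto
  moreover have "\<not> is_crossing (move A1 a, s) (move A2 b, t) (move A1 a)"
    using is_crossing_higher by blast
  ultimately show ?thesis
    using True finite_crossings by (simp add: crossings_def)
next
  case False
  then show ?thesis
    using is_crossing_Cons_Cons[OF assms] by (auto simp: crossings_def intro!: arg_cong[of _ _ card])
qed


section \<open>Recurrences for pairs of walks\<close>

text \<open>
At a common starting point the first path is regarded as having arrived there by \<open>E\<close> and the
second by \<open>N\<close>, as it happens when two paths meet of which the first came from the north-west.  The
starting point is then a crossing if and only if the paths separate in the same way.
\<close>

definition crossings_nw :: "point \<Rightarrow> point \<Rightarrow> step list \<Rightarrow> step list \<Rightarrow> nat" where
  "crossings_nw A1 A2 s t =
    \<chi> (A1, s) (A2, t) + (if A1 = A2 \<and> diverge E s t then 1 else 0)"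

definition pairs_nw :: "nat \<Rightarrow> point \<Rightarrow> point \<Rightarrow> point \<Rightarrow> point \<Rightarrow> (step list \<times> step list) set" where
  "pairs_nw r A1 A2 X Y =
    {(s, t). s \<in> walks A1 X \<and> t \<in> walks A2 Y \<and> r \<le> crossings_nw A1 A2 s t}"

lemma finite_pairs_nw: "finite (pairs_nw r A1 A2 X Y)"
  by (rule finite_subset[OF _ finite_cartesian_product[OF finite_walks[of A1 X] finite_walks[of A2 Y]]])
    (auto simp: pairs_nw_def)

lemma pairs_nw_0: "pairs_nw 0 A1 A2 X Y = walks A1 X \<times> walks A2 Y"
  by (auto simp: pairs_nw_def)

lemma pairs_nw_nonempty_walks:
  assumes "(s, t) \<in> pairs_nw (Suc r) A1 A2 X Y"
  shows "s \<noteq> []" "t \<noteq> []"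
  using assms by (auto simp: pairs_nw_def crossings_nw_def)

text \<open>
A walk without steps cannot take part in a crossing.
\<close>

lemma pairs_nw_beyond_end:
  assumes "height X \<le> height A1 \<or> height Y \<le> height A2"
  shows "pairs_nw (Suc r) A1 A2 X Y = {}"
proof (rule equals0I)
  fix p
  assume "p \<in> pairs_nw (Suc r) A1 A2 X Y"
  moreover obtain s t where "p = (s, t)"
    by fastforce
  ultimately have st: "(s, t) \<in> pairs_nw (Suc r) A1 A2 X Y"
    by simp
  then have "int (length s) = height X - height A1" "int (length t) = height Y - height A2"
    by (auto simp: pairs_nw_def intro: length_walk)
  moreover have "0 < length s" "0 < length t"
    using pairs_nw_nonempty_walks[OF st] by auto
  ultimately show False
    using assms by linarith
qed

lemma card_pairs_split_left:
  assumes "finite S" "\<And>s t. (s, t) \<in> S \<Longrightarrow> s \<noteq> []"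
  shows "card S = card {(s, t). (N # s, t) \<in> S} + card {(s, t). (E # s, t) \<in> S}"
proof -
  have *: "S \<subseteq> range (map_prod ((#) N) id) \<union> range (map_prod ((#) E) id)"
  proof
    fix p
    assume "p \<in> S"
    obtain s t where p: "p = (s, t)"
      by fastforce
    with \<open>p \<in> S\<close> obtain a s' where "s = a # s'"
      using assms(2) by (meson neq_Nil_conv)
    with p have "p = map_prod ((#) a) id (s', t)"
      by simp
    then show "p \<in> range (map_prod ((#) N) id) \<union> range (map_prod ((#) E) id)"
      by (cases a) blast+
  qed
  have "map_prod ((#) a) id -` S = {(s, t). (a # s, t) \<in> S}" for a
    by auto
  with card_vimage_split[OF assms(1) _ _ _ *] show ?thesis
    by (auto simp: prod.inj_map)
qed

lemma card_pairs_split_right: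
  assumes "finite S" "\<And>s t. (s, t) \<in> S \<Longrightarrow> t \<noteq> []"
  shows "card S = card {(s, t). (s, N # t) \<in> S} + card {(s, t). (s, E # t) \<in> S}"
proof -
  have *: "S \<subseteq> range (map_prod id ((#) N)) \<union> range (map_prod id ((#) E))"
  proof
    fix p
    assume "p \<in> S"
    obtain s t where p: "p = (s, t)"
      by fastforce
    with \<open>p \<in> S\<close> obtain a t' where "t = a # t'"
      using assms(2) by (meson neq_Nil_conv)
    with p have "p = map_prod id ((#) a) (s, t')"
      by simp
    then show "p \<in> range (map_prod id ((#) N)) \<union> range (map_prod id ((#) E))"
      by (cases a) blast+
  qed
  have "map_prod id ((#) a) -` S = {(s, t). (s, a # t) \<in> S}" for a
    by auto
  with card_vimage_split[OF assms(1) _ _ _ *] show ?thesis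
    by (auto simp: prod.inj_map)
qed

lemma card_pairs_split_both:
  assumes "finite S" "\<And>s t. (s, t) \<in> S \<Longrightarrow> s \<noteq> [] \<and> t \<noteq> []"
  shows "card S =
    card {(s, t). (N # s, N # t) \<in> S} + card {(s, t). (N # s, E # t) \<in> S} +
    card {(s, t). (E # s, N # t) \<in> S} + card {(s, t). (E # s, E # t) \<in> S}"
proof -
  have fin: "finite {(s, t). (a # s, t) \<in> S}" for a
    using finite_vimageI[OF assms(1), of "map_prod ((#) a) id"]
    by (auto simp: vimage_def prod.inj_map elim: finite_subset[rotated])
  have "card {(s, t). (a # s, t) \<in> S} =
      card {(s, t). (a # s, N # t) \<in> S} + card {(s, t). (a # s, E # t) \<in> S}" for a
    by (subst card_pairs_split_right[OF fin]) (use assms(2) in auto)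
  then show ?thesis
    using assms(2) by (subst card_pairs_split_left[OF assms(1)]) auto
qed

lemma card_pairs_nw_lower_left:
  assumes "height A1 < height A2" "A1 \<prec> A2"
  shows "card (pairs_nw (Suc r) A1 A2 X Y) =
    card (pairs_nw (Suc r) (move A1 N) A2 X Y) + card (pairs_nw (Suc r) (move A1 E) A2 X Y)"
proof -
  have "move A1 a \<noteq> A2" for a
    using assms(2) by (rule move_neq_prec)
  moreover have "A1 \<noteq> A2"
    using assms(1) by auto
  ultimately have "{(s, t). (a # s, t) \<in> pairs_nw (Suc r) A1 A2 X Y} = pairs_nw (Suc r) (move A1 a) A2 X Y" for a
    using crossings_Cons_left[OF assms(1)] by (auto simp: pairs_nw_def crossings_nw_def)
  then show ?thesis
    by (subst card_pairs_split_left[OF finite_pairs_nw]) (use pairs_nw_nonempty_walks in auto)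
qed

lemma card_pairs_nw_lower_right:
  assumes "height A2 < height A1" "A1 \<prec> A2"
  shows "card (pairs_nw (Suc r) A1 A2 X Y) =
    card (pairs_nw (Suc r) A1 (move A2 N) X Y) + card (pairs_nw (Suc r) A1 (move A2 E) X Y)"
proof -
  have "move A2 a \<noteq> A1" for a
    using assms(2) by (rule move_neq_prec)
  moreover have "A1 \<noteq> A2"
    using assms(1) by auto
  ultimately have "{(s, t). (s, a # t) \<in> pairs_nw (Suc r) A1 A2 X Y} = pairs_nw (Suc r) A1 (move A2 a) X Y" for a
    using crossings_Cons_right[OF assms(1)] by (auto simp: pairs_nw_def crossings_nw_def)
  then show ?thesis
    by (subst card_pairs_split_right[OF finite_pairs_nw]) (use pairs_nw_nonempty_walks in auto)
qed

text \<open>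
If the first steps lead to a common vertex, they are \<open>E\<close> and \<open>N\<close>, and the crossing that may be lost
there is exactly the one that \<open>crossings_nw\<close> adds for the shortened pair.
\<close>

lemma card_pairs_nw_same_height:
  assumes "height A1 = height A2" "A1 \<prec> A2"
  shows "card (pairs_nw (Suc r) A1 A2 X Y) =
    card (pairs_nw (Suc r) (move A1 N) (move A2 N) X Y) + card (pairs_nw (Suc r) (move A1 N) (move A2 E) X Y) +
    card (pairs_nw (Suc r) (move A1 E) (move A2 N) X Y) + card (pairs_nw (Suc r) (move A1 E) (move A2 E) X Y)"
proof -
  have "A1 \<noteq> A2"
    using assms(2) by (auto simp: prec_def)
  then have "{(s, t). (a # s, b # t) \<in> pairs_nw (Suc r) A1 A2 X Y} =
      pairs_nw (Suc r) (move A1 a) (move A2 b) X Y" for a b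
    using crossings_Cons_Cons[OF assms(1)] move_eq_move_prec[OF assms(2), of a b]
    by (auto simp: pairs_nw_def crossings_nw_def split: if_splits)
  then show ?thesis
    by (subst card_pairs_split_both[OF finite_pairs_nw]) (use pairs_nw_nonempty_walks in auto)
qed

text \<open>
A pair that leaves \<open>A\<close> with \<open>E\<close> and \<open>N\<close> has a crossing at \<open>A\<close>, so one crossing fewer is required
after \<open>A\<close>; the first walk is then the south-eastern one, and the pair is exchanged.
\<close>

lemma card_pairs_nw_same_point:
  "card (pairs_nw (Suc r) A A X Y) =
    card (pairs_nw (Suc r) (move A N) (move A N) X Y) + card (pairs_nw (Suc r) (move A N) (move A E) X Y) +
    card (pairs_nw r (move A N) (move A E) Y X) + card (pairs_nw (Suc r) (move A E) (move A E) X Y)"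
proof -
  let ?S = "\<lambda>a b. {(s, t). (a # s, b # t) \<in> pairs_nw (Suc r) A A X Y}"
  have ne: "move A N \<noteq> move A E" "move A E \<noteq> move A N"
    by (simp_all add: move_simps)
  have 1: "?S a a = pairs_nw (Suc r) (move A a) (move A a) X Y" for a
    by (auto simp: pairs_nw_def crossings_nw_def crossings_Cons_Cons)
  have 2: "?S N E = pairs_nw (Suc r) (move A N) (move A E) X Y"
    using ne by (auto simp: pairs_nw_def crossings_nw_def crossings_Cons_Cons)
  have 3: "?S E N = prod.swap ` pairs_nw r (move A N) (move A E) Y X"
    using ne crossings_commute[of "(move A E, _)" "(move A N, _)"]
    by (force simp: pairs_nw_def crossings_nw_def crossings_Cons_Cons image_iff)
  have 4: "card (?S E N) = card (pairs_nw r (move A N) (move A E) Y X)"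
    unfolding 3 by (simp add: card_image)
  show ?thesis
    by (subst card_pairs_split_both[OF finite_pairs_nw])
      (use pairs_nw_nonempty_walks 1 2 4 in auto)
qed


section \<open>The closed form\<close>

text \<open>
The number of pairs of walks from \<open>A1\<close> to \<open>B2 + (k, -k)\<close> and from \<open>A2\<close> to \<open>B1 - (k, -k)\<close>; the
displacement leaves the heights unchanged.
\<close>

definition shifted_pairs :: "int \<Rightarrow> point \<Rightarrow> point \<Rightarrow> point \<Rightarrow> point \<Rightarrow> nat" where
  "shifted_pairs k A1 A2 B1 B2 =
    binom (height B2 - height A1) (fst B2 - fst A1 + k) *
    binom (height B1 - height A2) (fst B1 - fst A2 - k)"

text \<open>
Here \<open>X\<close> and \<open>Y\<close> are the end points of the path that starts in the north-west and of the other one.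
If \<open>X \<prec> Y\<close> the number of crossings is even and otherwise, for \<open>Y \<prec> X\<close>, odd.  So two consecutive
values of \<open>r\<close> have to be given the same displacement: \<open>2 m - 1\<close> and \<open>2 m\<close> go to \<open>2 m - 1\<close> in the
first case, and \<open>2 m\<close> and \<open>2 m + 1\<close> go to \<open>2 m\<close> in the second.
\<close>

definition shift :: "point \<Rightarrow> point \<Rightarrow> nat \<Rightarrow> int" where
  "shift X Y r =
    (if X = Y then int r
     else if X \<prec> Y then 2 * ((int r + 1) div 2) - 1
     else 2 * (int r div 2))"

text \<open>
Requiring one crossing fewer and exchanging the end points lowers the displacement by one.  The three
rounding rules fit together because of this relation.
\<close>

lemma shift_swap:
  assumes "X = Y \<or> X \<prec> Y \<or> Y \<prec> X"
  shows "shift Y X r = shift X Y (Suc r) - 1"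
proof -
  have "(2 + int r) div 2 = int r div 2 + 1"
    by simp
  then show ?thesis
    using assms by (auto simp: shift_def prec_def)
qed

lemma shift_Suc_nonneg: "0 \<le> shift X Y (Suc r)"
  by (auto simp: shift_def)

text \<open>
The displaced walks exist only if \<open>B2\<close> is at least \<open>k\<close> above \<open>A1\<close> and \<open>B1\<close> at least \<open>k\<close> to the right
of \<open>A2\<close>.  The weak orders between the points then put both end points above both starting points
in height, strictly if \<open>k > 0\<close>.  For \<open>k = 0\<close> the ends are crossed, and strictness comes from
\<open>B1 \<prec> B2\<close>.
\<close>

lemma shifted_pairs_eq_0:
  assumes "A1 \<preceq> A2" "B1 \<preceq> B2" "(X, Y) = (B2, B1) \<or> (X, Y) = (B1, B2)"
    and "height X \<le> height A1 \<or> height Y \<le> height A2"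
  shows "shifted_pairs (shift X Y (Suc r)) A1 A2 B1 B2 = 0"
proof (rule ccontr)
  define k where "k = shift X Y (Suc r)"
  assume "shifted_pairs (shift X Y (Suc r)) A1 A2 B1 B2 \<noteq> 0"
  then have *: "snd B2 - snd A1 \<ge> k" "fst B1 - fst A2 \<ge> k"
    by (auto simp: shifted_pairs_def binom_def height_def k_def split: if_splits)
  have le: "fst A1 \<le> fst A2" "snd A2 \<le> snd A1" "fst B1 \<le> fst B2" "snd B2 \<le> snd B1"
    using assms(1,2) by (auto simp: weak_prec_def prec_def)
  have "0 \<le> k"
    by (simp add: k_def shift_Suc_nonneg)
  have B: "B1 \<prec> B2" "(X, Y) = (B2, B1)" if "k = 0"
  proof -
    have "2 * n - 1 \<noteq> (0 :: int)" for n
      by presburger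
    with that have "X \<noteq> Y" "\<not> X \<prec> Y"
      unfolding k_def shift_def by (metis of_nat_eq_0_iff nat.distinct(1))+
    then show "B1 \<prec> B2" "(X, Y) = (B2, B1)"
      using assms(2,3) by (auto simp: weak_prec_def)
  qed
  show False
  proof (cases "k = 0")
    case True
    then show False
      using B assms(4) * le by (auto simp: height_def prec_def)
  next
    case False
    then show False
      using \<open>0 \<le> k\<close> assms(3,4) * le by (auto simp: height_def)
  qed
qed

lemma shifted_pairs_pascal_left:
  assumes "height A1 < height B2"
  shows "shifted_pairs k A1 A2 B1 B2 =
    shifted_pairs k (move A1 N) A2 B1 B2 + shifted_pairs k (move A1 E) A2 B1 B2"
  using assms binom_pascal[of "height B2 - height A1" "fst B2 - fst A1 + k"]
  by (simp add: shifted_pairs_def algebra_simps)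

lemma shifted_pairs_pascal_right:
  assumes "height A2 < height B1"
  shows "shifted_pairs k A1 A2 B1 B2 =
    shifted_pairs k A1 (move A2 N) B1 B2 + shifted_pairs k A1 (move A2 E) B1 B2"
  using assms binom_pascal[of "height B1 - height A2" "fst B1 - fst A2 - k"]
  by (simp add: shifted_pairs_def algebra_simps)

lemma shifted_pairs_swap_steps:
  "shifted_pairs k (move A E) (move A N) B1 B2 = shifted_pairs (k - 1) (move A N) (move A E) B1 B2"
  by (simp add: shifted_pairs_def algebra_simps)

text \<open>
The recurrence at a common vertex can lower the required number of crossings to \<open>0\<close>, where the
closed form for \<open>X \<prec> Y\<close> does not count all pairs in general.  It does for these starting points:
the displacement is \<open>-1\<close>, and translating the displaced end points back to \<open>B1\<close> and \<open>B2\<close>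
exchanges \<open>A + N\<close> and \<open>A + E\<close>.
\<close>

lemma card_pairs_nw_0_swap_steps:
  assumes "B1 \<preceq> B2" "(X, Y) = (B2, B1) \<or> (X, Y) = (B1, B2)"
  shows "card (pairs_nw 0 (move A N) (move A E) X Y) =
    shifted_pairs (shift X Y 0) (move A N) (move A E) B1 B2"
  using assms
  by (auto simp: pairs_nw_0 card_cartesian_product card_walks shifted_pairs_def shift_def
      weak_prec_def prec_def algebra_simps)

text \<open>
For the lower of two points with \<open>A1 \<prec> A2\<close>, the gap between them is at least two in the
coordinate in which it lags behind, so one step cannot close it.
\<close>

lemma prec_moves:
  assumes "A1 \<prec> A2"
  shows "height A1 < height A2 \<Longrightarrow> move A1 a \<prec> A2"
    and "height A2 < height A1 \<Longrightarrow> A1 \<prec> move A2 a"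
    and "height A1 = height A2 \<Longrightarrow> move A1 a \<preceq> move A2 b"
  using assms by (cases a; cases b; auto simp: weak_prec_def prec_def height_def prod_eq_iff)+

text \<open>
Closed form and count satisfy the same recurrence.  The end points are allowed in either order because
the recurrence at a common vertex exchanges them.
\<close>

lemma card_pairs_nw:
  assumes "A1 \<preceq> A2" "B1 \<preceq> B2" "(X, Y) = (B2, B1) \<or> (X, Y) = (B1, B2)"
  shows "card (pairs_nw (Suc r) A1 A2 X Y) = shifted_pairs (shift X Y (Suc r)) A1 A2 B1 B2"
  using assms
proof (induction "nat (height X - height A1) + nat (height Y - height A2)"
    arbitrary: A1 A2 X Y r rule: less_induct)
  case less
  let ?k = "shift X Y (Suc r)"
  show ?case
  proof (cases "height X \<le> height A1 \<or> height Y \<le> height A2")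
    case True
    then show ?thesis
      using less.prems by (simp add: pairs_nw_beyond_end shifted_pairs_eq_0)
  next
    case False
    then have below: "height A1 < height X" "height A2 < height Y"
      by auto
    have IH: "card (pairs_nw (Suc r') A1' A2' X' Y') = shifted_pairs (shift X' Y' (Suc r')) A1' A2' B1 B2"
      if "nat (height X' - height A1') + nat (height Y' - height A2') <
          nat (height X - height A1) + nat (height Y - height A2)"
        "A1' \<preceq> A2'" "(X', Y') = (X, Y) \<or> (X', Y') = (Y, X)" for r' A1' A2' X' Y'
      using less.hyps[OF that(1,2) less.prems(2)] less.prems(3) that(3) by auto
    consider "A1 \<prec> A2" "height A1 < height A2" | "A1 \<prec> A2" "height A2 < height A1"
      | "A1 \<prec> A2" "height A1 = height A2" | "A1 = A2"
      using less.prems(1) unfolding weak_prec_def by linarith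
    then show ?thesis
    proof cases
      case 1
      have "card (pairs_nw (Suc r) (move A1 a) A2 X Y) = shifted_pairs ?k (move A1 a) A2 B1 B2" for a
        by (rule IH) (use below 1 prec_moves(1)[OF 1] in \<open>auto simp: weak_prec_def\<close>)
      moreover have "height A1 < height B2"
        using below 1 less.prems(3) by auto
      ultimately show ?thesis
        using card_pairs_nw_lower_left[OF 1(2,1)] shifted_pairs_pascal_left by simp
    next
      case 2
      have "card (pairs_nw (Suc r) A1 (move A2 a) X Y) = shifted_pairs ?k A1 (move A2 a) B1 B2" for a
        by (rule IH) (use below 2 prec_moves(2)[OF 2] in \<open>auto simp: weak_prec_def\<close>)
      moreover have "height A2 < height B1"
        using below 2 less.prems(3) by auto
      ultimately show ?thesis
        using card_pairs_nw_lower_right[OF 2(2,1)] shifted_pairs_pascal_right by simp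
    next
      case 3
      have "card (pairs_nw (Suc r) (move A1 a) (move A2 b) X Y) =
          shifted_pairs ?k (move A1 a) (move A2 b) B1 B2" for a b
        by (rule IH) (use below 3 prec_moves(3)[OF 3] in auto)
      moreover have "height A1 < height B2" "height A2 < height B1"
        using below 3 less.prems(3) by auto
      ultimately show ?thesis
        using card_pairs_nw_same_height[OF 3(2,1)] shifted_pairs_pascal_left[of A1 B2 ?k A2 B1]
          shifted_pairs_pascal_right[of A2 B1 ?k "move A1 _" B2] by simp
    next
      case 4
      have NE: "move A1 N \<preceq> move A1 E"
        by (simp add: weak_prec_def prec_def)
      have "card (pairs_nw (Suc r) (move A1 a) (move A1 a) X Y) =
          shifted_pairs ?k (move A1 a) (move A1 a) B1 B2" for a
        by (rule IH) (use below 4 in \<open>auto simp: weak_prec_def\<close>)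
      moreover have "card (pairs_nw (Suc r) (move A1 N) (move A1 E) X Y) =
          shifted_pairs ?k (move A1 N) (move A1 E) B1 B2"
        by (rule IH) (use below 4 NE in auto)
      moreover have "card (pairs_nw r (move A1 N) (move A1 E) Y X) =
          shifted_pairs (shift Y X r) (move A1 N) (move A1 E) B1 B2"
      proof (cases r)
        case 0
        then show ?thesis
          using card_pairs_nw_0_swap_steps[OF less.prems(2), of Y X A1] less.prems(3) unfolding 0 by blast
      next
        case (Suc r')
        show ?thesis
          unfolding Suc by (rule IH) (use below 4 NE in auto)
      qed
      moreover have "shift Y X r = ?k - 1"
        using less.prems(2,3) by (intro shift_swap) (auto simp: weak_prec_def)
      moreover have "height A1 < height B2" "height A1 < height B1"
        using below 4 less.prems(3) by auto
      ultimately show ?thesis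
        using card_pairs_nw_same_point[of r A1 X Y] shifted_pairs_pascal_left[of A1 B2 ?k A1 B1]
          shifted_pairs_pascal_right[of A1 B1 ?k "move A1 _" B2] 4
        by (simp add: shifted_pairs_swap_steps)
    qed
  qed
qed


section \<open>Walks with a common starting point\<close>

lemma path_pairs_eq_image:
  "path_pairs r A1 X A2 Y =
    (\<lambda>(s, t). ((A1, s), (A2, t))) ` {(s, t). s \<in> walks A1 X \<and> t \<in> walks A2 Y \<and> r \<le> \<chi> (A1, s) (A2, t)}"
  by (auto simp: path_pairs_def paths_def walks_def vertex_def image_iff)

lemma card_path_pairs:
  "card (path_pairs r A1 X A2 Y) =
    card {(s, t). s \<in> walks A1 X \<and> t \<in> walks A2 Y \<and> r \<le> \<chi> (A1, s) (A2, t)}"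
  unfolding path_pairs_eq_image by (rule card_image) (auto simp: inj_on_def)

lemma card_path_pairs_0: "card (path_pairs 0 A1 X A2 Y) = card (walks A1 X) * card (walks A2 Y)"
  by (simp add: card_path_pairs card_cartesian_product[symmetric] flip: Collect_case_prod_Sigma)

lemma card_path_pairs_prec:
  assumes "A1 \<prec> A2"
  shows "card (path_pairs r A1 X A2 Y) = card (pairs_nw r A1 A2 X Y)"
  using assms by (auto simp: card_path_pairs pairs_nw_def crossings_nw_def prec_def intro!: arg_cong[of _ _ card])

lemma diverge_flip: "diverge N s t \<longleftrightarrow> diverge E t s"
proof (induction N s t rule: diverge.induct)
  case (1 a s b t)
  then show ?case
    by (cases a; cases b) auto
qed auto

lemma diverge_exclusive: "diverge E s t \<Longrightarrow> \<not> diverge N s t"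
  by (induction E s t rule: diverge.induct) auto

text \<open>
Walks that never disagree are prefixes of one another, so their end points are not in the relation
\<open>\<prec>\<close>.
\<close>

lemma diverge_or_prefix: "diverge E s t \<or> diverge N s t \<or> (\<exists>u. t = s @ u) \<or> (\<exists>u. s = t @ u)"
proof (induction E s t rule: diverge.induct)
  case (1 a s b t)
  then show ?case
    by (cases a; cases b) auto
qed auto

lemma crossings_same [simp]: "\<chi> (A, s) (A, s) = 0"
  by (induction s arbitrary: A) (simp_all add: crossings_Cons_Cons)

lemma foldl_move_mono: "fst A \<le> fst (foldl move A s) \<and> snd A \<le> snd (foldl move A s)"
proof (induction s arbitrary: A)
  case (Cons a s)
  from Cons[of "move A a"] show ?case
    by (cases a) auto
qed simp

text \<open>
Let \<open>U\<close> and \<open>V\<close> be the pairs that have at least \<open>r + 1\<close> crossings when the first, respectively the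
second, walk is regarded as arriving from the north-west.  A pair that separates gains a crossing from
exactly one of the two conventions, so \<open>U \<union> V\<close> consists of the pairs with at least \<open>r\<close> crossings and
\<open>U \<inter> V\<close> of those with at least \<open>r + 1\<close>.
\<close>

lemma card_path_pairs_same_start:
  assumes "X = Y \<and> 0 < r \<or> X \<prec> Y"
  shows "card (path_pairs (Suc r) A X A Y) + card (path_pairs r A X A Y) =
    card (pairs_nw (Suc r) A A X Y) + card (pairs_nw (Suc r) A A Y X)"
proof -
  define G where "G q = {(s, t). s \<in> walks A X \<and> t \<in> walks A Y \<and> q \<le> \<chi> (A, s) (A, t)}" for q
  define U where "U = pairs_nw (Suc r) A A X Y"
  define V where "V = prod.swap ` pairs_nw (Suc r) A A Y X"
  have V: "V = {(s, t). s \<in> walks A X \<and> t \<in> walks A Y \<and>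
      Suc r \<le> \<chi> (A, s) (A, t) + (if diverge N s t then 1 else 0)}"
    using crossings_commute[of "(A, _)" "(A, _)"]
    by (force simp: V_def pairs_nw_def crossings_nw_def diverge_flip image_iff split: if_splits)
  have "diverge E s t \<or> diverge N s t" if "(s, t) \<in> G r" for s t
  proof (rule ccontr)
    assume "\<not> ?thesis"
    then have prefix: "(\<exists>u. t = s @ u) \<or> (\<exists>u. s = t @ u)"
      using diverge_or_prefix by blast
    have st: "foldl move A s = X" "foldl move A t = Y" "r \<le> \<chi> (A, s) (A, t)"
      using that by (auto simp: G_def walks_def)
    from prefix have "\<not> X \<prec> Y"
    proof (elim disjE exE)
      fix u
      assume "t = s @ u"
      then show ?thesis
        using st foldl_move_mono[of X u] by (auto simp: prec_def)
    next
      fix u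
      assume "s = t @ u"
      then show ?thesis
        using st foldl_move_mono[of Y u] by (auto simp: prec_def)
    qed
    then have XY: "X = Y" "0 < r"
      using assms by auto
    then have "length s = length t"
      using st height_foldl_move[of A s] height_foldl_move[of A t] by simp
    with prefix have "s = t"
      by auto
    with st(3) XY(2) show False
      by simp
  qed
  then have "U \<union> V = G r"
    by (auto simp: U_def V G_def pairs_nw_def crossings_nw_def split: if_splits)
  moreover have "U \<inter> V = G (Suc r)"
    using diverge_exclusive by (auto simp: U_def V G_def pairs_nw_def crossings_nw_def split: if_splits)
  moreover have "card U + card V = card (U \<union> V) + card (U \<inter> V)"
    by (rule card_Un_Int) (auto simp: U_def V_def finite_pairs_nw)
  moreover have "card V = card (pairs_nw (Suc r) A A Y X)"
    unfolding V_def by (simp add: card_image)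
  ultimately show ?thesis
    by (simp add: card_path_pairs U_def G_def)
qed

text \<open>
Of the two displacements for \<open>r + 1\<close>, one is \<open>r\<close> and the other is \<open>r + 1\<close>.  Hence the sum of consecutive
counts equals the sum of consecutive closed forms, and the claim propagates from \<open>r = 0\<close>.
\<close>

lemma card_path_pairs_same_start_prec:
  assumes "B1 \<prec> B2"
  shows "card (path_pairs r A B1 A B2) = shifted_pairs (int r) A A B1 B2"
proof (induction r)
  case 0
  then show ?case
    by (simp add: card_path_pairs_0 card_walks shifted_pairs_def)
next
  case (Suc r)
  have neq: "B1 \<noteq> B2" "\<not> B2 \<prec> B1"
    using assms by (auto simp: prec_def)
  have "card (path_pairs (Suc r) A B1 A B2) + card (path_pairs r A B1 A B2) =
      shifted_pairs (shift B1 B2 (Suc r)) A A B1 B2 + shifted_pairs (shift B2 B1 (Suc r)) A A B1 B2"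
    using assms card_pairs_nw[of A A B1 B2 B1 B2 r] card_pairs_nw[of A A B1 B2 B2 B1 r]
    by (simp add: card_path_pairs_same_start weak_prec_def)
  also have "\<dots> = shifted_pairs (int (Suc r)) A A B1 B2 + shifted_pairs (int r) A A B1 B2"
  proof (cases "even r")
    case True
    then have "shift B1 B2 (Suc r) = int r + 1 \<and> shift B2 B1 (Suc r) = int r"
      using neq assms by (auto simp: shift_def elim!: evenE)
    then show ?thesis
      by (simp add: add.commute)
  next
    case False
    then have "shift B1 B2 (Suc r) = int r \<and> shift B2 B1 (Suc r) = int r + 1"
      using neq assms by (auto simp: shift_def elim!: oddE)
    then show ?thesis
      by (simp add: add.commute)
  qed
  finally show ?case
    using Suc by simp
qed

text \<open>
Consecutive counts add up to twice the closed form, so the alternating sum telescopes; the last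
count vanishes because a displacement beyond the width of the walks leaves nothing.
\<close>

lemma card_path_pairs_same_ends:
  assumes "0 < r"
  shows "int (card (path_pairs r A B A B)) =
    2 * (\<Sum>\<^sub>\<infinity>j\<in>{1::nat..}. (-1) ^ (j - 1) * int (shifted_pairs (int r + int j) A A B B))"
proof -
  define g where "g q = int (card (path_pairs q A B A B))" for q
  define a where "a j = int (shifted_pairs (int r + int j) A A B B)" for j :: nat
  have rec: "g (r + Suc j) + g (r + j) = 2 * a (Suc j)" for j
  proof -
    have "card (path_pairs (Suc (r + j)) A B A B) + card (path_pairs (r + j) A B A B) =
        2 * shifted_pairs (int (Suc (r + j))) A A B B"
      using assms card_pairs_nw[of A A B B B B "r + j"]
      by (simp add: card_path_pairs_same_start weak_prec_def shift_def)
    from arg_cong[OF this, of int] show ?thesis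
      by (simp add: g_def a_def add_ac)
  qed
  have partial: "2 * (\<Sum>j=1..m. (-1) ^ (j - 1) * a j) = g r - (-1) ^ m * g (r + m)" for m
  proof (induction m)
    case (Suc m)
    have "2 * (\<Sum>j=1..Suc m. (-1) ^ (j - 1) * a j) = g r - (-1) ^ m * g (r + m) + (-1) ^ m * (2 * a (Suc m))"
      using Suc by (simp add: algebra_simps)
    then show ?case
      by (simp add: rec[symmetric] algebra_simps)
  qed simp
  \<comment> \<open>For \<open>j > M\<close> the end point displaced to the left lies to the left of \<open>A\<close>.\<close>
  define M where "M = nat (fst B - fst A)"
  have a0: "a j = 0" if "M < j" for j
    using that assms by (auto simp: a_def shifted_pairs_def binom_def M_def)
  have "g (r + M) = 0"
    using rec[of M] a0[of "Suc M"] by (simp add: g_def)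
  with partial[of M] have "g r = 2 * (\<Sum>j=1..M. (-1) ^ (j - 1) * a j)"
    by simp
  also have "(\<Sum>j=1..M. (-1) ^ (j - 1) * a j) = (\<Sum>\<^sub>\<infinity>j\<in>{1..M}. (-1) ^ (j - 1) * a j)"
    by simp
  also have "\<dots> = (\<Sum>\<^sub>\<infinity>j\<in>{1..}. (-1) ^ (j - 1) * a j)"
    by (rule infsum_cong_neutral) (use a0 in auto)
  finally show ?thesis
    by (simp add: g_def a_def)
qed

section \<open>The enumeration\<close>

lemma card_path_pairs_same_end:
  assumes "A1 \<prec> A2"
  shows "card (path_pairs r A1 B A2 B) = shifted_pairs (int r) A1 A2 B B"
proof (cases r)
  case 0
  then show ?thesis
    by (simp add: card_path_pairs_0 card_walks shifted_pairs_def)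
next
  case (Suc q)
  then show ?thesis
    using assms card_pairs_nw[of A1 A2 B B B B q]
    by (simp add: card_path_pairs_prec shift_def weak_prec_def)
qed

lemma card_path_pairs_crossed_ends:
  assumes "A1 \<prec> A2" "B1 \<prec> B2"
  shows "card (path_pairs r A1 B2 A2 B1) = shifted_pairs (2 * (int r div 2)) A1 A2 B1 B2"
proof (cases r)
  case 0
  then show ?thesis
    by (simp add: card_path_pairs_0 card_walks shifted_pairs_def)
next
  case (Suc q)
  have "B1 \<noteq> B2" "\<not> B2 \<prec> B1"
    using assms(2) by (auto simp: prec_def)
  with Suc show ?thesis
    using assms card_pairs_nw[of A1 A2 B1 B2 B2 B1 q]
    by (simp add: card_path_pairs_prec shift_def weak_prec_def)
qed

lemma card_path_pairs_uncrossed_ends: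
  assumes "A1 \<prec> A2" "B1 \<prec> B2" "0 < r"
  shows "card (path_pairs r A1 B1 A2 B2) = shifted_pairs (2 * ((int r + 1) div 2) - 1) A1 A2 B1 B2"
proof -
  obtain q where r: "r = Suc q"
    using assms(3) gr0_implies_Suc by blast
  have "B1 \<noteq> B2"
    using assms(2) by (auto simp: prec_def)
  then show ?thesis
    using assms(1,2) card_pairs_nw[of A1 A2 B1 B2 B1 B2 q] unfolding r
    by (simp add: card_path_pairs_prec shift_def weak_prec_def)
qed

theorem theorem2p3:
  fixes A1 A2 B1 B2 :: point
    and x1 y1 x2 y2 u1 v1 u2 v2 :: int
  assumes "A1 = (x1, y1)" "A2 = (x2, y2)" "B1 = (u1, v1)" "B2 = (u2, v2)"
    and "A1 \<prec> A2" "B1 \<prec> B2"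
  shows "(\<forall>m::nat.
      card (path_pairs (2 * m + 1) A1 B2 A2 B1) = card (path_pairs (2 * m) A1 B2 A2 B1) \<and>
      card (path_pairs (2 * m) A1 B2 A2 B1) =
        binom (u2 - x1 + v2 - y1) (u2 - x1 + 2 * int m) *
        binom (u1 - x2 + v1 - y2) (u1 - x2 - 2 * int m)) \<and>
    (\<forall>m::nat. m \<ge> 1 \<longrightarrow>
      card (path_pairs (2 * m) A1 B1 A2 B2) = card (path_pairs (2 * m - 1) A1 B1 A2 B2) \<and>
      card (path_pairs (2 * m - 1) A1 B1 A2 B2) =
        binom (u2 - x1 + v2 - y1) (u2 - x1 + 2 * int m - 1) *
        binom (u1 - x2 + v1 - y2) (u1 - x2 - 2 * int m + 1)) \<and>
    (\<forall>(A::point) (B::point) (x::int) (y::int) (u::int) (v::int). A = (x, y) \<and> B = (u, v) \<longrightarrow> (\<forall>r::nat.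
      card (path_pairs r A B1 A B2) =
        binom (u2 - x + v2 - y) (u2 - x + int r) * binom (u1 - x + v1 - y) (u1 - x - int r) \<and>
      card (path_pairs r A1 B A2 B) =
        binom (u - x1 + v - y1) (u - x1 + int r) * binom (u - x2 + v - y2) (u - x2 - int r) \<and>
      int (card (path_pairs r A B A B)) =
        (if r = 0 then (int (binom (u - x + v - y) (u - x)))\<^sup>2
         else 2 * (\<Sum>\<^sub>\<infinity>j\<in>{1::nat..}. (-1) ^ (j - 1) *
                int (binom (u - x + v - y) (u - x + int r + int j)) *
                int (binom (u - x + v - y) (u - x - int r - int j))))))"
proof -
  have coords: "fst A1 = x1" "height A1 = x1 + y1" "fst A2 = x2" "height A2 = x2 + y2"
    "fst B1 = u1" "height B1 = u1 + v1" "fst B2 = u2" "height B2 = u2 + v2"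
    using assms(1-4) by (simp_all add: height_def)
  have crossed: "card (path_pairs (2 * m + 1) A1 B2 A2 B1) = card (path_pairs (2 * m) A1 B2 A2 B1) \<and>
      card (path_pairs (2 * m) A1 B2 A2 B1) =
        binom (u2 - x1 + v2 - y1) (u2 - x1 + 2 * int m) *
        binom (u1 - x2 + v1 - y2) (u1 - x2 - 2 * int m)" for m
    using assms(5,6) by (simp add: card_path_pairs_crossed_ends shifted_pairs_def coords add_diff_eq diff_add_eq diff_diff_eq)
  have uncrossed: "card (path_pairs (2 * m) A1 B1 A2 B2) = card (path_pairs (2 * m - 1) A1 B1 A2 B2) \<and>
      card (path_pairs (2 * m - 1) A1 B1 A2 B2) =
        binom (u2 - x1 + v2 - y1) (u2 - x1 + 2 * int m - 1) *
        binom (u1 - x2 + v1 - y2) (u1 - x2 - 2 * int m + 1)" if "1 \<le> m" for m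
  proof -
    have "(int (2 * m) + 1) div 2 = int m" "(int (2 * m - 1) + 1) div 2 = int m"
      using that by (simp_all add: of_nat_diff)
    then show ?thesis
      using assms(5,6) that
      by (simp add: card_path_pairs_uncrossed_ends shifted_pairs_def coords algebra_simps)
  qed
  have start: "card (path_pairs r (x, y) B1 (x, y) B2) =
        binom (u2 - x + v2 - y) (u2 - x + int r) * binom (u1 - x + v1 - y) (u1 - x - int r)" for x y r
    using assms(6) height_def[of "(x, y)"]
    by (simp add: card_path_pairs_same_start_prec shifted_pairs_def coords algebra_simps)
  have fin: "card (path_pairs r A1 (u, v) A2 (u, v)) =
        binom (u - x1 + v - y1) (u - x1 + int r) * binom (u - x2 + v - y2) (u - x2 - int r)" for u v r
    using assms(5) height_def[of "(u, v)"]
    by (simp add: card_path_pairs_same_end shifted_pairs_def coords algebra_simps)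
  have both: "int (card (path_pairs r (x, y) (u, v) (x, y) (u, v))) =
        (if r = 0 then (int (binom (u - x + v - y) (u - x)))\<^sup>2
         else 2 * (\<Sum>\<^sub>\<infinity>j\<in>{1::nat..}. (-1) ^ (j - 1) *
                int (binom (u - x + v - y) (u - x + int r + int j)) *
                int (binom (u - x + v - y) (u - x - int r - int j))))" for x y u v r
  proof (cases "r = 0")
    case True
    then show ?thesis
      by (simp add: card_path_pairs_0 card_walks height_def power2_eq_square algebra_simps)
  next
    case False
    have "(-1) ^ (j - 1) * int (shifted_pairs (int r + int j) (x, y) (x, y) (u, v) (u, v)) =
        (-1) ^ (j - 1) * int (binom (u - x + v - y) (u - x + int r + int j)) *
          int (binom (u - x + v - y) (u - x - int r - int j))" for j
      by (simp add: shifted_pairs_def height_def algebra_simps)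
    with False show ?thesis
      by (simp only: card_path_pairs_same_ends if_False)
  qed
  show ?thesis
    using crossed uncrossed start fin both by blast
qed

end
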